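(* Let $X$ and $Y$ be real locally convex topological vector spaces in duality through a bilinear product $\langle\cdot,\cdot\rangle : X\times Y\to\mathbb{R}$, with topologies compatible with the duality. Given a non-empty set $M\subset X\times Y$, there exists a bipotential $b: X\times Y\to\mathbb{R}\cup\{+\infty\}$ such that $M=M(b)$ if and only if $M$ is a BB-graph.
   Context: Setting: $X,Y$ are real locally convex topological vector spaces with a bilinear duality product $\langle\cdot,\cdot\rangle:X\times Y\to\mathbb{R}$. The topologies are compatible with the duality: the continuous linear functionals on $X$ are exactly the maps $x\mapsto\langle x,y\rangle$, $y\in Y$, and the continuous linear functionals on $Y$ are exactly the maps $y\mapsto\langle x,y\rangle$, $x\in X$. Write $\bar{\mathbb{R}}=\mathbb{R}\cup\{+\infty\}$. Subgradients: for $\phi:X\to\bar{\mathbb{R}}$ and $x\in X$ with $\phi(x)<+\infty$, $\partial\phi(x)=\{u\in Y : \langle z-x,u\rangle\le\phi(z)-\phi(x)\ \ \forall z\in X\}$; if $\phi(x)=+\infty$, then $\partial\phi(x)=\emptyset$. Subgradients of functions $\psi:Y\to\bar{\mathbb{R}}$ are defined in the same way and are subsets of $X$. Bipotential: a function $b:X\times Y\to\bar{\mathbb{R}}$ such that (a) $b$ is convex and lower semicontinuous in each argument separately; (b) $b(x,y)\ge\langle x,y\rangle$ for all $(x,y)\in X\times Y$; (c) for all $(x,y)\in X\times Y$: $y\in\partial b(\cdot,y)(x)\iff x\in\partial b(x,\cdot)(y)\iff b(x,y)=\langle x,y\rangle$. The graph of $b$ is $M(b)=\{(x,y)\in X\times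 Y : b(x,y)=\langle x,y\rangle\}$. BB-graph: for $M\subset X\times Y$ put $m(x)=\{y\in Y:(x,y)\in M\}$, $m^*(y)=\{x\in X:(x,y)\in M\}$, $\mathrm{dom}(M)=\{x\in X : m(x)\neq\emptyset\}$, $\mathrm{im}(M)=\{y\in Y : m^*(y)\ne\emptyset\}$. A non-empty set $M$ is a BB-graph (bi-convex, bi-closed) if for all $x\in\mathrm{dom}(M)$ and all $y\in\mathrm{im}(M)$ the sets $m(x)$ and $m^*(y)$ are convex and closed. *)

theory Defs
  imports "HOL-Analysis.Analysis"
begin

(* The Hausdorff property is deliberately not part of the class. The convexity of V is unfolded
   because the constant convex, with its sort constraint, cannot occur in a class axiom; see
   locally_convex_zero below. *)
class locally_convex_space = real_vector + topological_ab_group_add +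
  assumes tendsto_scaleR_Pair:
    "LIM p (nhds (c::real) \<times>\<^sub>F nhds x). fst p *\<^sub>R snd p :> nhds (c *\<^sub>R x)"
  assumes locally_convex_zero_unfolded:
    "open U \<Longrightarrow> 0 \<in> U \<Longrightarrow> \<exists>V. open V \<and> 0 \<in> V \<and>
       (\<forall>x\<in>V. \<forall>y\<in>V. \<forall>u\<ge>0. \<forall>v\<ge>0. u + v = (1::real) \<longrightarrow> u *\<^sub>R x + v *\<^sub>R y \<in> V) \<and> V \<subseteq> U"

lemma locally_convex_zero:
  fixes U :: "'a::locally_convex_space set"
  assumes "open U" "0 \<in> U"
  shows "\<exists>V. open V \<and> 0 \<in> V \<and> convex V \<and> V \<subseteq> U"
  using locally_convex_zero_unfolded[OF assms] by (simp add: convex_def)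

definition continuous_dual :: "('a::{real_vector,topological_space} \<Rightarrow> real) set" where
  "continuous_dual = {f. linear f \<and> continuous_on UNIV f}"

definition duality_product ::
    "('a::locally_convex_space \<Rightarrow> 'b::locally_convex_space \<Rightarrow> real) \<Rightarrow> bool" where
  "duality_product p \<longleftrightarrow> bilinear p \<and>
     continuous_dual = range (\<lambda>y x. p x y) \<and>
     continuous_dual = range (\<lambda>x y. p x y)"

(* Functions into the reals extended by +\<infinity> are modelled as ereal-valued functions that
   never take the value -\<infinity>; see bipotential. *)

(* At t = 0 and t = 1 the inequality is trivial, since 0 * \<infinity> = 0 in ereal. *)
definition convex_fun :: "('a::real_vector \<Rightarrow> ereal) \<Rightarrow> bool" where
  "convex_fun \<phi> \<longleftrightarrow> (\<forall>x z. \<forall>t\<in>{0..1::real}.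
     \<phi> ((1 - t) *\<^sub>R x + t *\<^sub>R z) \<le> ereal (1 - t) * \<phi> x + ereal t * \<phi> z)"

definition lower_semicontinuous :: "('a::topological_space \<Rightarrow> ereal) \<Rightarrow> bool" where
  "lower_semicontinuous \<phi> \<longleftrightarrow> (\<forall>x. \<forall>a<\<phi> x. eventually (\<lambda>z. a < \<phi> z) (nhds x))"

(* For functions on the second space, p is to be used with its arguments swapped. *)
definition subgradients ::
    "('a::real_vector \<Rightarrow> 'b \<Rightarrow> real) \<Rightarrow> ('a \<Rightarrow> ereal) \<Rightarrow> 'a \<Rightarrow> 'b set" where
  "subgradients p \<phi> x =
     (if \<phi> x < \<infinity> then {u. \<forall>z. ereal (p (z - x) u) \<le> \<phi> z - \<phi> x} else {})"

definition bipotential ::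
    "('a::locally_convex_space \<Rightarrow> 'b::locally_convex_space \<Rightarrow> real) \<Rightarrow> ('a \<Rightarrow> 'b \<Rightarrow> ereal) \<Rightarrow> bool" where
  "bipotential p b \<longleftrightarrow>
     (\<forall>x y. b x y \<noteq> -\<infinity>) \<and>
     (\<forall>y. convex_fun (\<lambda>x. b x y) \<and> lower_semicontinuous (\<lambda>x. b x y)) \<and>
     (\<forall>x. convex_fun (\<lambda>y. b x y) \<and> lower_semicontinuous (\<lambda>y. b x y)) \<and>
     (\<forall>x y. ereal (p x y) \<le> b x y) \<and>
     (\<forall>x y. (y \<in> subgradients p (\<lambda>z. b z y) x \<longleftrightarrow> b x y = ereal (p x y)) \<and>
            (x \<in> subgradients (\<lambda>v u. p u v) (\<lambda>v. b x v) y \<longleftrightarrow> b x y = ereal (p x y)))"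

definition bipotential_graph :: "('a \<Rightarrow> 'b \<Rightarrow> real) \<Rightarrow> ('a \<Rightarrow> 'b \<Rightarrow> ereal) \<Rightarrow> ('a \<times> 'b) set" where
  "bipotential_graph p b = {(x, y). b x y = ereal (p x y)}"

(* m(x) is the relational image M `` {x}, and m*(y) is the image of {y} under the converse;
   dom(M) and im(M) are Domain M and Range M. *)
definition BB_graph :: "('a::locally_convex_space \<times> 'b::locally_convex_space) set \<Rightarrow> bool" where
  "BB_graph M \<longleftrightarrow> M \<noteq> {} \<and>
     (\<forall>x\<in>Domain M. convex (M `` {x}) \<and> closed (M `` {x})) \<and>
     (\<forall>y\<in>Range M. convex (M\<inverse> `` {y}) \<and> closed (M\<inverse> `` {y}))"

end

theory Submission
  imports Defs
begin

text \<open>If \<open>b\<close> is a bipotential, the sections of its graph are the sets where a convex lower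
  semicontinuous function attains a continuous linear minorant. Conversely, the function equal to
  the duality product on a BB-graph \<open>M\<close> and to \<open>\<infinity>\<close> elsewhere is a bipotential with graph \<open>M\<close>:
  each of its partial functions is a continuous linear function plus the indicator function of a
  closed convex set.\<close>

text \<open>As \<open>f\<close> is a minorant, equality at a point amounts to \<open>\<phi>\<close>
  \<le> \<open>f\<close> there. At a convex combination of contact points, convexity bounds
  \<open>\<phi>\<close> by the combination of the values of \<open>f\<close>, which linearity turns
  into the value of \<open>f\<close>.\<close>

lemma convex_contact_set:
  fixes f :: "'a::real_vector \<Rightarrow> real"
  assumes "convex_fun \<phi>" "linear f" "\<And>x. ereal (f x) \<le> \<phi> x"
  shows "convex {x. \<phi> x = ereal (f x)}"
  unfolding convex_alt
proof (intro ballI allI impI)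
  fix x z and t :: real
  assume x: "x \<in> {x. \<phi> x = ereal (f x)}" and z: "z \<in> {x. \<phi> x = ereal (f x)}"
    and t: "0 \<le> t \<and> t \<le> 1"
  let ?w = "(1 - t) *\<^sub>R x + t *\<^sub>R z"
  have "\<phi> ?w \<le> ereal (1 - t) * \<phi> x + ereal t * \<phi> z"
    using assms(1) t by (simp add: convex_fun_def)
  also have "\<dots> = ereal (f ?w)"
    using x z assms(2) by (simp add: linear_add linear_scale)
  finally show "?w \<in> {x. \<phi> x = ereal (f x)}"
    using assms(3)[of ?w] by (simp add: antisym)
qed

text \<open>The complement is the set where \<open>f\<close> lies strictly below
  \<open>\<phi>\<close>. It is open: a real number strictly between the two values at a point still
  separates them nearby, by continuity of \<open>f\<close> and semicontinuity of
  \<open>\<phi>\<close>.\<close>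

lemma closed_contact_set:
  fixes f :: "'a::topological_space \<Rightarrow> real"
  assumes "lower_semicontinuous \<phi>" "continuous_on UNIV f" "\<And>x. ereal (f x) \<le> \<phi> x"
  shows "closed {x. \<phi> x = ereal (f x)}"
proof -
  have "eventually (\<lambda>z. ereal (f z) < \<phi> z) (nhds x)" if less: "ereal (f x) < \<phi> x" for x
  proof -
    obtain c where c: "ereal (f x) < ereal c" "ereal c < \<phi> x"
      using ereal_dense2[OF less] by blast
    have "(f \<longlongrightarrow> f x) (nhds x)"
      using assms(2) by (simp add: continuous_on_def tendsto_at_iff_tendsto_nhds)
    then have "eventually (\<lambda>z. f z < c) (nhds x)"
      using c(1) by (simp add: order_tendstoD(2))
    moreover have "eventually (\<lambda>z. ereal c < \<phi> z) (nhds x)"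
      using assms(1) c(2) by (auto simp: lower_semicontinuous_def)
    ultimately show ?thesis
      by eventually_elim (meson less_ereal.simps(1) less_trans)
  qed
  then have "open {x. ereal (f x) < \<phi> x}"
    by (subst open_subopen) (auto simp: eventually_nhds subset_eq)
  moreover have "- {x. \<phi> x = ereal (f x)} = {x. ereal (f x) < \<phi> x}"
    using assms(3) by (force simp: less_le)
  ultimately show ?thesis
    by (simp add: closed_def)
qed

lemma convex_fun_restrict_linear:
  fixes f :: "'a::real_vector \<Rightarrow> real"
  assumes "linear f" "convex S"
  shows "convex_fun (\<lambda>x. if x \<in> S then ereal (f x) else \<infinity>)"
  unfolding convex_fun_def
proof (intro allI ballI)
  fix x z :: 'a and t :: real
  assume t: "t \<in> {0..1}"
  let ?\<phi> = "\<lambda>x. if x \<in> S then ereal (f x) else \<infinity>" and ?w = "(1 - t) *\<^sub>R x + t *\<^sub>R z"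
  \<comment> \<open>The endpoints are split off because 0 * \<infinity> = 0: there the right-hand
    side can be finite although one of the points lies outside \<open>S\<close>.\<close>
  consider "t = 0" | "t = 1" | "0 < t" "t < 1" "x \<in> S" "z \<in> S" | "0 < t" "t < 1" "x \<notin> S \<or> z \<notin> S"
    using t by fastforce
  then show "?\<phi> ?w \<le> ereal (1 - t) * ?\<phi> x + ereal t * ?\<phi> z"
  proof cases
    case 3
    then have "?w \<in> S"
      using assms(2) by (simp add: convex_alt)
    with 3 show ?thesis
      using assms(1) by (simp add: linear_add linear_scale)
  next
    case 4
    then have "ereal (1 - t) * ?\<phi> x + ereal t * ?\<phi> z = \<infinity>"
      by auto
    then show ?thesis
      by (simp only: ereal_less_eq)
  qed (simp_all flip: zero_ereal_def one_ereal_def)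
qed

lemma lower_semicontinuous_restrict_continuous:
  fixes f :: "'a::topological_space \<Rightarrow> real"
  assumes "continuous_on UNIV f" "closed S"
  shows "lower_semicontinuous (\<lambda>x. if x \<in> S then ereal (f x) else \<infinity>)"
  unfolding lower_semicontinuous_def
proof (intro allI impI)
  fix x a
  assume a: "a < (if x \<in> S then ereal (f x) else \<infinity>)"
  show "eventually (\<lambda>z. a < (if z \<in> S then ereal (f z) else \<infinity>)) (nhds x)"
  proof (cases "x \<in> S")
    case True
    have "((\<lambda>z. ereal (f z)) \<longlongrightarrow> ereal (f x)) (nhds x)"
      using assms(1) by (simp add: continuous_on_def tendsto_at_iff_tendsto_nhds)
    then have "eventually (\<lambda>z. a < ereal (f z)) (nhds x)"
      by (rule order_tendstoD) (use a True in simp)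
    then show ?thesis
      by eventually_elim auto
  next
    case False
    \<comment> \<open>Off \<open>S\<close> the function is constantly \<infinity> on an open
      neighbourhood.\<close>
    then have "eventually (\<lambda>z. z \<in> - S) (nhds x)"
      using assms(2) by (intro eventually_nhds_in_open) auto
    then show ?thesis
      using a False by (auto elim: eventually_mono)
  qed
qed

text \<open>For \<open>x\<close> in \<open>S\<close>, the subgradient inequality is an equality at
  points of \<open>S\<close> by linearity, and its right-hand side is \<infinity> elsewhere. For
  \<open>x\<close> outside \<open>S\<close> the value is \<infinity>, so there are no
  subgradients.\<close>

lemma mem_subgradients_restrict_linear:
  assumes "linear (\<lambda>x. p x u)"
  shows "u \<in> subgradients p (\<lambda>x. if x \<in> S then ereal (p x u) else \<infinity>) x \<longleftrightarrow> x \<in> S"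
  using linear_diff[OF assms] by (auto simp: subgradients_def)

lemma duality_productD:
  assumes "duality_product p"
  shows "linear (\<lambda>x. p x y)" "continuous_on UNIV (\<lambda>x. p x y)"
    and "linear (\<lambda>y. p x y)" "continuous_on UNIV (\<lambda>y. p x y)"
  using assms unfolding duality_product_def continuous_dual_def by blast+

lemma BB_graph_bipotential_graph:
  assumes p: "duality_product p" and b: "bipotential p b" and ne: "bipotential_graph p b \<noteq> {}"
  shows "BB_graph (bipotential_graph p b)"
proof -
  have "bipotential_graph p b `` {x} = {y. b x y = ereal (p x y)}"
    and "(bipotential_graph p b)\<inverse> `` {y} = {x. b x y = ereal (p x y)}" for x y
    by (auto simp: bipotential_graph_def)
  then show ?thesis
    using b ne duality_productD[OF p]
    by (auto simp: BB_graph_def bipotential_def intro!: convex_contact_set closed_contact_set)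
qed

lemma bipotential_restrict_duality_product:
  assumes p: "duality_product p" and M: "BB_graph M"
  shows "bipotential p (\<lambda>x y. if (x, y) \<in> M then ereal (p x y) else \<infinity>)"
proof -
  have sec: "convex {y. (x, y) \<in> M}" "closed {y. (x, y) \<in> M}" for x
  proof -
    \<comment> \<open>\<open>BB_graph\<close> only speaks of \<open>x\<close> in the domain; all
      other sections are empty, hence convex and closed too.\<close>
    have "{y. (x, y) \<in> M} = M `` {x}" "x \<notin> Domain M \<Longrightarrow> M `` {x} = {}"
      by auto
    then show "convex {y. (x, y) \<in> M}" "closed {y. (x, y) \<in> M}"
      using M by (metis BB_graph_def convex_empty, metis BB_graph_def closed_empty)
  qed
  have sec': "convex {x. (x, y) \<in> M}" "closed {x. (x, y) \<in> M}" for y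
  proof -
    have "{x. (x, y) \<in> M} = M\<inverse> `` {y}" "y \<notin> Range M \<Longrightarrow> M\<inverse> `` {y} = {}"
      by auto
    then show "convex {x. (x, y) \<in> M}" "closed {x. (x, y) \<in> M}"
      using M by (metis BB_graph_def convex_empty, metis BB_graph_def closed_empty)
  qed
  note lin = duality_productD[OF p]
  show ?thesis
    unfolding bipotential_def
    using convex_fun_restrict_linear[OF lin(1) sec'(1)]
      convex_fun_restrict_linear[OF lin(3) sec(1)]
      lower_semicontinuous_restrict_continuous[OF lin(2) sec'(2)]
      lower_semicontinuous_restrict_continuous[OF lin(4) sec(2)]
      mem_subgradients_restrict_linear[of p, OF lin(1), of _ "{x. (x, y) \<in> M}" for y]
      \<comment> \<open>The arguments of \<open>p\<close> are swapped, as \<open>bipotential\<close>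
        does for subgradients in the second variable.\<close>
      mem_subgradients_restrict_linear[of "\<lambda>u v. p v u", OF lin(3), of _ "{y. (x, y) \<in> M}" for x]
    by simp
qed

theorem theorem3p2:
  fixes p :: "'a::locally_convex_space \<Rightarrow> 'b::locally_convex_space \<Rightarrow> real"
    and M :: "('a \<times> 'b) set"
  assumes "duality_product p"
    and "M \<noteq> {}"
  shows "(\<exists>b :: 'a \<Rightarrow> 'b \<Rightarrow> ereal. bipotential p b \<and> M = bipotential_graph p b) \<longleftrightarrow> BB_graph M"
proof
  assume "\<exists>b. bipotential p b \<and> M = bipotential_graph p b"
  then show "BB_graph M"
    using BB_graph_bipotential_graph assms by blast
next
  assume "BB_graph M"
  \<comment> \<open>The value \<infinity> never equals a real number, so no point outside
    \<open>M\<close> enters the graph.\<close>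
  moreover have "M = bipotential_graph p (\<lambda>x y. if (x, y) \<in> M then ereal (p x y) else \<infinity>)"
    by (auto simp: bipotential_graph_def)
  ultimately show "\<exists>b. bipotential p b \<and> M = bipotential_graph p b"
    using bipotential_restrict_duality_product[OF assms(1)] by blast
qed

end
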